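(* Let $m = q^k n^2$ be an odd perfect number with special prime $q$. Then $$I(q^k) + I(n^2) > l_1(q,n), \qquad\text{where}\qquad l_1(q,n) = \frac{3q^2 - 4q + 2}{q(q - 1)} - \frac{q}{(q - 1)(2qn^2 - 2n^2 + 1)} + \frac{1}{qn^2}.$$ In particular, there exists a real number $K$ such that $k < K$ and $g(K) = l_1(q,n)$.
   Context: For a positive integer $x$, $\sigma(x)=\sum_{d\mid x} d$ is the sum of its positive divisors and $I(x)=\sigma(x)/x$ is its abundancy index. An odd perfect number is an odd positive integer $m$ with $\sigma(m)=2m$. "$q^k n^2$ is an odd perfect number with special prime $q$" means that $m=q^k n^2$ is an odd perfect number, where $k,n$ are positive integers, $q$ is a prime, $q\equiv k\equiv 1 \pmod 4$, and $\gcd(q,n)=1$ (Euler's form). For fixed $q$, the function $g$ of a real variable $x\ge 1$ is $$g(x)=3-\frac{(q^x-1)(q^{x+1}-2q^x+1)}{q^x(q-1)(q^{x+1}-1)};$$ for the given odd perfect number one has $g(k)=I(q^k)+I(n^2)$. *)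

theory Defs
  imports Complex_Main "HOL-Computational_Algebra.Primes" "HOL-Number_Theory.Cong"
begin

text \<open>Only used at positive arguments; at 0 the divisor set is infinite and the sum is 0.\<close>

definition sigma :: "nat \<Rightarrow> nat" where
  "sigma x = (\<Sum>d | d dvd x. d)"

definition abundancy :: "nat \<Rightarrow> real" where
  "abundancy x = real (sigma x) / real x"

definition odd_perfect :: "nat \<Rightarrow> bool" where
  "odd_perfect m \<longleftrightarrow> m > 0 \<and> odd m \<and> sigma m = 2 * m"

text \<open>Euler's form: \<open>q ^ k * n\<^sup>2\<close> is an odd perfect number with special prime \<open>q\<close>.\<close>

definition odd_perfect_special_prime :: "nat \<Rightarrow> nat \<Rightarrow> nat \<Rightarrow> bool" where
  "odd_perfect_special_prime q k n \<longleftrightarrow>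
     odd_perfect (q ^ k * n\<^sup>2) \<and> k > 0 \<and> n > 0 \<and> prime q \<and>
     [q = 1] (mod 4) \<and> [k = 1] (mod 4) \<and> coprime q n"

text \<open>Intended for a special prime \<open>q\<close> and real \<open>x \<ge> 1\<close>; \<open>g q (real k)\<close> is then
  \<open>abundancy (q ^ k) + abundancy (n\<^sup>2)\<close>.\<close>

definition g :: "nat \<Rightarrow> real \<Rightarrow> real" where
  "g q x = 3 -
     ((real q powr x - 1) * (real q powr (x + 1) - 2 * real q powr x + 1)) /
     (real q powr x * (real q - 1) * (real q powr (x + 1) - 1))"

definition l1 :: "nat \<Rightarrow> nat \<Rightarrow> real" where
  "l1 q n =
     (3 * (real q)\<^sup>2 - 4 * real q + 2) / (real q * (real q - 1))
     - real q / ((real q - 1) * (2 * real q * (real n)\<^sup>2 - 2 * (real n)\<^sup>2 + 1))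
     + 1 / (real q * (real n)\<^sup>2)"

end

theory Submission
  imports Defs
begin

text \<open>
  Write \<open>t\<close> for the abundancy of \<open>q ^ k\<close>. Since the abundancies of \<open>q ^ k\<close> and \<open>n\<^sup>2\<close> multiply
  to \<open>2\<close>, their sum is \<open>t + 2 / t\<close>. With \<open>y = q ^ k\<close> one has \<open>t = (q y - 1) / (y (q - 1))\<close>, and
  \<open>g q x\<close> is the same expression \<open>t + 2 / t\<close> at \<open>y = q powr x\<close>. The bound \<open>l1 q n\<close> is the value
  belonging to \<open>y\<^sub>0 = (2 (q - 1) n\<^sup>2 + 1) / q\<close>, the real solution of \<open>(q y - 1) / (q - 1) = 2 n\<^sup>2\<close>,
  so \<open>K\<close> is the logarithm of \<open>y\<^sub>0\<close> to base \<open>q\<close>. Now \<open>t\<close> increases with \<open>y\<close> but stays below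
  \<open>q / (q - 1) \<le> 5 / 4 < sqrt 2\<close>, and on this range \<open>t + 2 / t\<close> decreases. Both claims therefore
  amount to \<open>q ^ k < y\<^sub>0\<close>, that is, to \<open>sigma (q ^ k) < 2 n\<^sup>2\<close>.

  From \<open>sigma (q ^ k) * sigma (n\<^sup>2) = 2 q ^ k n\<^sup>2\<close> and the coprimality of \<open>q ^ k\<close> and
  \<open>sigma (q ^ k)\<close> it follows that \<open>sigma (q ^ k)\<close> divides \<open>2 n\<^sup>2\<close>, so only equality has to be
  excluded (\<open>sigma_prime_power_neq\<close>). Equality forces \<open>sigma (n\<^sup>2) = q ^ k\<close>, so for each prime
  power \<open>p ^ a\<close> exactly dividing \<open>n\<close> the number \<open>c = sigma (p ^ (2 a))\<close> is a power of \<open>q\<close>.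
  Here \<open>c\<close> is \<open>1 + p\<close> modulo \<open>p\<^sup>2\<close>, while \<open>p ^ (2 a)\<close> divides \<open>q ^ (k + 1) - 1\<close>
  and hence \<open>c ^ (k + 1) - 1\<close>. Lifting the exponent (\<open>lifting_exponent\<close>) gives
  \<open>p ^ (2 a - 1) dvd k + 1\<close>. Thus \<open>n\<close> divides \<open>k + 1\<close>, and so does \<open>2 n\<close>, since \<open>n\<close> and \<open>k\<close> are odd.
  This gives \<open>2 sigma (q ^ k) = (2 n)\<^sup>2 \<le> (k + 1)\<^sup>2\<close>, which contradicts \<open>sigma (q ^ k) > 5 ^ k\<close>.
\<close>

section \<open>Values of the divisor sum\<close>

lemma sigma_mult_coprime:
  assumes "coprime a b"
  shows "sigma (a * b) = sigma a * sigma b"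
proof -
  let ?S = "{d. d dvd a} \<times> {d. d dvd b}"
  have img: "{d. d dvd a * b} = (\<lambda>(x, y). x * y) ` ?S"
  proof (intro equalityI subsetI)
    fix d assume "d \<in> {d. d dvd a * b}"
    then obtain x y where "d = x * y" "x dvd a" "y dvd b"
      using division_decomp[of d a b] by auto
    then show "d \<in> (\<lambda>(x, y). x * y) ` ?S" by force
  next
    fix d assume "d \<in> (\<lambda>(x, y). x * y) ` ?S"
    then show "d \<in> {d. d dvd a * b}" by (auto intro: mult_dvd_mono)
  qed
  have dvd: "x dvd x'" if "x * y = x' * y'" "x dvd a" "y' dvd b" for x y x' y'
  proof -
    have "coprime x y'" using assms that(2,3) by (meson coprime_divisors)
    moreover have "x dvd x' * y'" using that(1) by (metis dvd_triv_left)
    ultimately show ?thesis by (simp add: coprime_dvd_mult_left_iff)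
  qed
  have inj: "inj_on (\<lambda>(x, y). x * y) ?S"
  proof (rule inj_onI, clarify)
    fix x y x' y' assume *: "x dvd a" "y dvd b" "x' dvd a" "y' dvd b" "x * y = x' * y'"
    have "x = x'" using dvd[of x y x' y'] dvd[of x' y' x y] * by (simp add: dvd_antisym)
    moreover have "y dvd y'"
    proof -
      have "coprime y x'" using assms *(2,3) by (meson coprime_divisors coprime_commute)
      moreover have "y dvd x' * y'" using *(5) by (metis dvd_triv_right)
      ultimately show ?thesis by (simp add: coprime_dvd_mult_right_iff)
    qed
    moreover have "y' dvd y"
    proof -
      have "coprime y' x" using assms *(1,4) by (meson coprime_divisors coprime_commute)
      moreover have "y' dvd x * y" using *(5) by (metis dvd_triv_right)
      ultimately show ?thesis by (simp add: coprime_dvd_mult_right_iff)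
    qed
    ultimately show "x = x' \<and> y = y'" by (simp add: dvd_antisym)
  qed
  have "sigma (a * b) = (\<Sum>(x, y)\<in>?S. x * y)"
    unfolding sigma_def img by (subst sum.reindex[OF inj]) (simp add: case_prod_unfold)
  also have "\<dots> = sigma a * sigma b"
    unfolding sigma_def by (simp add: sum_product sum.cartesian_product)
  finally show ?thesis .
qed

lemma sigma_prime_power:
  assumes "prime p"
  shows "sigma (p ^ k) = (\<Sum>i\<le>k. p ^ i)"
proof -
  have img: "{d. d dvd p ^ k} = (\<lambda>i. p ^ i) ` {..k}"
    using divides_primepow_nat[OF assms] by auto
  have inj: "inj_on (\<lambda>i. p ^ i) {..k}"
    using prime_gt_1_nat[OF assms] by (auto intro!: inj_onI simp: power_inject_exp)
  show ?thesis unfolding sigma_def img by (subst sum.reindex[OF inj]) simp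
qed

lemma sigma_prime_power_closed:
  assumes "prime p"
  shows "(int p - 1) * int (sigma (p ^ k)) = int p ^ Suc k - 1"
  using power_diff_1_eq[of "int p" "Suc k"]
  by (simp add: sigma_prime_power[OF assms] lessThan_Suc_atMost)

lemma coprime_sigma_prime_power:
  assumes "prime p"
  shows "coprime (p ^ k) (sigma (p ^ k))"
proof -
  have "\<not> p dvd sigma (p ^ k)"
  proof
    assume "p dvd sigma (p ^ k)"
    then have "int p dvd int p ^ Suc k - 1"
      by (metis sigma_prime_power_closed[OF assms] dvd_mult of_nat_dvd_iff)
    then have "int p dvd 1"
      by (metis dvd_diff_right_iff dvd_power dvd_triv_left power_Suc)
    then show False using prime_gt_1_nat[OF assms] by auto
  qed
  then show ?thesis using assms by (simp add: prime_imp_coprime)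
qed

lemma sigma_prime_power_eq_mod_square:
  assumes "prime p" "k > 0"
  shows "\<exists>s. sigma (p ^ k) = 1 + p + p\<^sup>2 * s"
proof -
  obtain j where k: "k = Suc j" using assms(2) by (cases k) auto
  have "sigma (p ^ k) = 1 + p * (\<Sum>i\<le>j. p ^ i)"
    unfolding sigma_prime_power[OF assms(1)] k sum.atMost_Suc_shift
    by (simp add: sum_distrib_left)
  moreover have "\<exists>s. (\<Sum>i\<le>j. p ^ i) = 1 + p * s"
    by (cases j) (auto simp: sum.atMost_Suc_shift sum_distrib_left[symmetric] simp del: sum.atMost_Suc)
  ultimately show ?thesis by (auto simp: algebra_simps power2_eq_square)
qed

section \<open>Lifting the exponent\<close>

lemma power_one_plus_mod_square:
  fixes u p :: int
  shows "\<exists>w. (1 + p * u) ^ i = 1 + int i * p * u + p\<^sup>2 * w"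
proof (induction i)
  case 0
  show ?case by (rule exI[of _ 0]) simp
next
  case (Suc i)
  then obtain w where w: "(1 + p * u) ^ i = 1 + int i * p * u + p\<^sup>2 * w" by blast
  show ?case
    by (rule exI[of _ "int i * u\<^sup>2 + w + p * u * w"])
      (simp add: w algebra_simps power2_eq_square)
qed

text \<open>
  Expand \<open>x = 1 + p u\<close> modulo \<open>p\<^sup>2\<close>: the constant terms sum to \<open>p\<close> and the linear terms to
  \<open>p u\<close> times \<open>p (p - 1) / 2\<close>, which is a multiple of \<open>p\<^sup>2\<close> because \<open>p\<close> is odd.
\<close>

lemma sum_powers_exactly_divisible:
  fixes x :: int and p :: nat
  assumes "odd p" "int p dvd x - 1"
  shows "\<exists>v. (\<Sum>i<p. x ^ i) = int p * (1 + int p * v)"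
proof -
  obtain u where x: "x = 1 + int p * u"
    using assms(2) by (metis dvdE add.commute diff_add_cancel)
  obtain w where w: "\<And>i. x ^ i = 1 + int i * int p * u + (int p)\<^sup>2 * w i"
    using power_one_plus_mod_square[of "int p" u] unfolding x by metis
  obtain h where h: "p = 2 * h + 1" using assms(1) by (auto elim: oddE)
  have gauss: "(\<Sum>i<2 * m + 1. int i) = (2 * int m + 1) * int m" for m
    by (induction m) (simp_all add: algebra_simps)
  have "(\<Sum>i<p. x ^ i) = int p + int p * u * (\<Sum>i<p. int i) + (int p)\<^sup>2 * (\<Sum>i<p. w i)"
    unfolding w by (simp add: sum.distrib sum_distrib_left sum_distrib_right mult_ac)
  also have "(\<Sum>i<p. int i) = int p * int h"
    using gauss[of h] by (simp add: h algebra_simps)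
  finally have "(\<Sum>i<p. x ^ i) = int p * (1 + int p * (u * int h + (\<Sum>i<p. w i)))"
    by (simp add: algebra_simps power2_eq_square)
  then show ?thesis by blast
qed

lemma prime_dvd_exponent:
  fixes c :: int and p :: nat
  assumes "prime p" "int p dvd c - 1" "\<not> (int p)\<^sup>2 dvd c - 1" "(int p)\<^sup>2 dvd c ^ t - 1"
  shows "p dvd t"
proof -
  obtain e where e: "c - 1 = int p * e" using assms(2) by (elim dvdE)
  have "\<not> int p dvd e" using assms(3) unfolding e by (auto simp: power2_eq_square)
  have "(int p)\<^sup>2 dvd int p * e * (\<Sum>i<t. c ^ i)"
    using assms(4) by (simp add: power_diff_1_eq e)
  then have "int p dvd e * (\<Sum>i<t. c ^ i)"
    using prime_gt_0_nat[OF assms(1)] by (simp add: power2_eq_square mult.assoc)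
  then have S: "int p dvd (\<Sum>i<t. c ^ i)"
    using assms(1) \<open>\<not> int p dvd e\<close> by (simp add: prime_dvd_mult_iff)
  have "int p dvd c ^ i - 1" for i
    using assms(2) by (simp add: power_diff_1_eq)
  then have "int p dvd (\<Sum>i<t. c ^ i - 1)" by (simp add: dvd_sum)
  then have "int p dvd (\<Sum>i<t. c ^ i) - int t" by (simp add: sum_subtractf)
  with S have "int p dvd int t" by (meson dvd_diff_right_iff)
  then show ?thesis by simp
qed

text \<open>
  Each step of the induction removes one factor \<open>p\<close> from the exponent: writing \<open>t = p s\<close>, the
  quotient of \<open>c ^ t - 1\<close> by \<open>c ^ s - 1\<close> contains \<open>p\<close> exactly once.
\<close>

lemma lifting_exponent:
  fixes c :: int and p :: nat
  assumes "prime p" "odd p" "int p dvd c - 1" "\<not> (int p)\<^sup>2 dvd c - 1"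
    and "int p ^ Suc j dvd c ^ t - 1"
  shows "p ^ j dvd t"
  using assms(5)
proof (induction j arbitrary: t)
  case 0
  show ?case by simp
next
  case (Suc j)
  have "(int p)\<^sup>2 dvd int p ^ Suc (Suc j)"
    by (rule le_imp_power_dvd) simp
  then have "p dvd t"
    using prime_dvd_exponent[OF assms(1,3,4)] Suc.prems dvd_trans by blast
  then obtain s where s: "t = p * s" by (elim dvdE)
  have "int p dvd c ^ s - 1" using assms(3) by (simp add: power_diff_1_eq)
  then obtain v where v: "(\<Sum>i<p. (c ^ s) ^ i) = int p * (1 + int p * v)"
    using sum_powers_exactly_divisible[OF assms(2)] by blast
  have "c ^ t - 1 = (c ^ s - 1) * (int p * (1 + int p * v))"
    by (simp add: s mult.commute[of p s] power_mult power_diff_1_eq[of "c ^ s"] v)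
  then have "int p * int p ^ Suc j dvd int p * ((c ^ s - 1) * (1 + int p * v))"
    using Suc.prems by (simp add: mult_ac)
  then have "int p ^ Suc j dvd (c ^ s - 1) * (1 + int p * v)"
    using prime_gt_0_nat[OF assms(1)] by (subst (asm) dvd_mult_cancel_left) simp
  moreover have "coprime (int p) (1 + int p * v)"
    by (metis coprime_1_right coprime_iff_gcd_eq_1 gcd_add_mult add.commute mult.commute)
  then have "coprime (int p ^ Suc j) (1 + int p * v)"
    by (rule coprime_power_left_iff[THEN iffD2, OF disjI1])
  ultimately have "int p ^ Suc j dvd c ^ s - 1"
    by (simp only: coprime_dvd_mult_left_iff)
  then have "p ^ j dvd s" by (rule Suc.IH)
  then show ?case by (simp add: s mult_dvd_mono)
qed

section \<open>The divisor sum of the special prime power is not twice a square\<close>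

text \<open>
  The first hypothesis on \<open>sigma\<close> makes
  \<open>sigma (p ^ (2 a))\<close> a power \<open>c\<close> of \<open>q\<close> that is \<open>1\<close> modulo \<open>p\<close> but not modulo \<open>p\<^sup>2\<close>; the second
  makes \<open>q ^ Suc k\<close>, hence \<open>c ^ Suc k\<close>, equal to \<open>1\<close> modulo \<open>p ^ (2 a)\<close>. All but one of these
  \<open>2 a\<close> factors must come from the exponent, and \<open>2 a - 1 \<ge> a\<close>.
\<close>

lemma prime_power_dvd_exponent:
  fixes p q k n :: nat
  assumes "prime p" "p dvd n" "odd n" "prime q"
    and sn: "sigma (n\<^sup>2) = q ^ k" and sq: "sigma (q ^ k) = 2 * n\<^sup>2"
  shows "p ^ multiplicity p n dvd Suc k"
proof -
  define a where "a = multiplicity p n"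
  have "n \<noteq> 0" using assms(3) by (cases n) auto
  then obtain r where n: "n = p ^ a * r" and "\<not> p dvd r"
    using multiplicity_decompose'[of n p] assms(1) unfolding a_def by (metis not_prime_unit)
  have a: "a > 0" using assms(2) \<open>\<not> p dvd r\<close> n by (cases a) auto
  have "odd p" using assms(2,3) dvd_trans by blast
  have "coprime p r" using assms(1) \<open>\<not> p dvd r\<close> by (simp add: prime_imp_coprime)
  have n2: "n\<^sup>2 = p ^ (2 * a) * r\<^sup>2"
    by (simp add: n power_mult_distrib power_mult[symmetric] mult.commute)
  have "sigma (n\<^sup>2) = sigma (p ^ (2 * a)) * sigma (r\<^sup>2)"
    unfolding n2 using \<open>coprime p r\<close> by (intro sigma_mult_coprime) simp
  then have "sigma (p ^ (2 * a)) dvd q ^ k" using sn by (metis dvd_triv_left)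
  then obtain b where b: "sigma (p ^ (2 * a)) = q ^ b"
    using divides_primepow_nat[OF assms(4)] by auto
  obtain s where s: "q ^ b = 1 + p + p\<^sup>2 * s"
    using sigma_prime_power_eq_mod_square[OF assms(1), of "2 * a"] a b by auto
  define c where "c = int q ^ b"
  have c: "c - 1 = int p * (1 + int p * int s)"
    using arg_cong[OF s, of int] by (simp add: c_def power2_eq_square algebra_simps)
  have c1: "int p dvd c - 1" by (simp add: c)
  have c2: "\<not> (int p)\<^sup>2 dvd c - 1"
  proof
    assume "(int p)\<^sup>2 dvd c - 1"
    then have "int p dvd 1 + int p * int s"
      using prime_gt_0_nat[OF assms(1)] by (simp add: c power2_eq_square)
    then have "int p dvd 1" by (metis dvd_add_left_iff dvd_triv_left)
    then show False using prime_gt_1_nat[OF assms(1)] by simp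
  qed
  have "int p ^ (2 * a) dvd int (sigma (q ^ k))" by (simp add: sq n2)
  then have "int p ^ (2 * a) dvd int q ^ Suc k - 1"
    by (metis sigma_prime_power_closed[OF assms(4)] dvd_mult)
  moreover have "int q ^ Suc k - 1 dvd c ^ Suc k - 1"
    using power_diff_1_eq[of "int q ^ Suc k" b]
    by (simp add: c_def power_mult[symmetric] mult.commute[of b] del: power_Suc)
  ultimately have "int p ^ Suc (2 * a - 1) dvd c ^ Suc k - 1"
    using a dvd_trans by (simp del: power_Suc) blast
  then have "p ^ (2 * a - 1) dvd Suc k"
    by (rule lifting_exponent[OF assms(1) \<open>odd p\<close> c1 c2])
  moreover have "p ^ a dvd p ^ (2 * a - 1)" using a by (intro le_imp_power_dvd) simp
  ultimately show ?thesis unfolding a_def[symmetric] by (rule dvd_trans[rotated])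
qed

text \<open>
  The previous lemma gives \<open>n dvd Suc k\<close>, and parity improves this to \<open>2 * n dvd Suc k\<close>. The
  extra factor is used at \<open>k = 1\<close>, where \<open>n \<le> Suc k\<close> would only give \<open>sigma q \<le> 8\<close>, which
  \<open>q = 5\<close> satisfies.
\<close>

lemma sigma_prime_power_neq:
  fixes q k n :: nat
  assumes "odd n" "prime q" "q \<ge> 5" "odd k"
    and sn: "sigma (n\<^sup>2) = q ^ k"
  shows "sigma (q ^ k) \<noteq> 2 * n\<^sup>2"
proof
  assume sq: "sigma (q ^ k) = 2 * n\<^sup>2"
  have "n \<noteq> 0" using assms(1) by (cases n) auto
  have "n dvd Suc k"
  proof (rule multiplicity_le_imp_dvd)
    fix p :: nat assume p: "prime p"
    show "multiplicity p n \<le> multiplicity p (Suc k)"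
    proof (cases "p dvd n")
      case True
      show ?thesis
        using prime_power_dvd_exponent[OF p True assms(1,2) sn sq]
        by (intro multiplicity_geI) (use p in auto)
    qed (simp add: not_dvd_imp_multiplicity_0)
  qed (use \<open>n \<noteq> 0\<close> in simp)
  moreover have "even (Suc k)" using assms(4) by simp
  ultimately have "2 * n dvd Suc k" using assms(1) by (intro divides_mult) auto
  then have "2 * n \<le> Suc k" by (rule dvd_imp_le) simp
  then have "(2 * n)\<^sup>2 \<le> (Suc k)\<^sup>2" by (rule power_mono) simp
  then have upper: "2 * sigma (q ^ k) \<le> (Suc k)\<^sup>2" by (simp add: sq power_mult_distrib)
  have "5 ^ k \<le> q ^ k" using assms(3) by (rule power_mono) simp
  also have "\<dots> \<le> sigma (q ^ k)"
    unfolding sigma_prime_power[OF assms(2)] by (rule member_le_sum) auto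
  finally have "2 * 5 ^ k \<le> (Suc k)\<^sup>2" using upper by simp
  moreover have "(Suc j)\<^sup>2 < 2 * 5 ^ j" for j :: nat
    by (induction j) (auto simp: power2_eq_square algebra_simps)
  ultimately show False using not_le by blast
qed

text \<open>
  Being coprime to \<open>q ^ k\<close>, the divisor \<open>sigma (q ^ k)\<close> of \<open>2 q ^ k n\<^sup>2\<close> divides \<open>2 n\<^sup>2\<close>.
\<close>

lemma sigma_special_prime_power_less:
  assumes "odd_perfect_special_prime q k n"
  shows "sigma (q ^ k) < 2 * n\<^sup>2" "sigma (q ^ k) * sigma (n\<^sup>2) = 2 * (q ^ k * n\<^sup>2)" "q \<ge> 5"
proof -
  have q: "prime q" and n: "n > 0" "odd n" and k: "odd k" and cop: "coprime q n"
    and perf: "sigma (q ^ k * n\<^sup>2) = 2 * (q ^ k * n\<^sup>2)"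
    using assms by (auto simp: odd_perfect_special_prime_def odd_perfect_def cong_def) presburger
  have "q mod 4 = 1" using assms by (simp add: odd_perfect_special_prime_def cong_def)
  then show "q \<ge> 5" using prime_gt_1_nat[OF q] by presburger
  show prod: "sigma (q ^ k) * sigma (n\<^sup>2) = 2 * (q ^ k * n\<^sup>2)"
    using perf cop by (simp add: sigma_mult_coprime)
  have "sigma (q ^ k) dvd q ^ k * (2 * n\<^sup>2)"
    using prod by (metis dvd_triv_left mult.left_commute)
  then have "sigma (q ^ k) dvd 2 * n\<^sup>2"
    using coprime_sigma_prime_power[OF q, of k]
    by (simp add: coprime_dvd_mult_right_iff coprime_commute)
  then have "sigma (q ^ k) \<le> 2 * n\<^sup>2" using n by (intro dvd_imp_le) auto
  moreover have "sigma (q ^ k) \<noteq> 2 * n\<^sup>2"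
  proof
    assume eq: "sigma (q ^ k) = 2 * n\<^sup>2"
    then have "sigma (n\<^sup>2) = q ^ k" using prod n by simp
    from sigma_prime_power_neq[OF n(2) q \<open>q \<ge> 5\<close> k this] eq show False by simp
  qed
  ultimately show "sigma (q ^ k) < 2 * n\<^sup>2" by simp
qed

section \<open>The abundancy of a prime power as a real function\<close>

definition power_abundancy :: "real \<Rightarrow> real \<Rightarrow> real" where
  "power_abundancy q y = (q * y - 1) / (y * (q - 1))"

lemma abundancy_prime_power:
  assumes "prime q"
  shows "abundancy (q ^ k) = power_abundancy (real q) (real (q ^ k))"
proof -
  have "(real q - 1) * real (sigma (q ^ k)) = real q * real q ^ k - 1"
    using arg_cong[OF sigma_prime_power_closed[OF assms, of k], of real_of_int] by simp
  then show ?thesis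
    using prime_gt_1_nat[OF assms]
    by (simp add: abundancy_def power_abundancy_def frac_eq_eq mult_ac)
qed

lemma power_abundancy_strict_mono:
  assumes "q > 1" "0 < y" "y < z"
  shows "power_abundancy q y < power_abundancy q z"
proof -
  have "(q - 1) * y < (q - 1) * z" using assms by (intro mult_strict_left_mono) auto
  then show ?thesis using assms by (simp add: power_abundancy_def field_simps)
qed

lemma power_abundancy_bounds:
  assumes "q \<ge> 5" "y \<ge> 1"
  shows "0 < power_abundancy q y" "power_abundancy q y < 5 / 4"
proof -
  have "q * 1 \<le> q * y" using assms by (intro mult_left_mono) auto
  then have "q * y - 1 > 0" using assms(1) by linarith
  then show "0 < power_abundancy q y"
    unfolding power_abundancy_def using assms by (intro divide_pos_pos mult_pos_pos) auto
  have "5 * y \<le> q * y" using assms by (intro mult_right_mono) auto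
  then have "q * y - 1 < 5 / 4 * (y * (q - 1))" by (simp add: algebra_simps)
  then show "power_abundancy q y < 5 / 4"
    using assms by (simp add: power_abundancy_def pos_divide_less_eq)
qed

text \<open>
  The right side exceeds the left one by \<open>(t - s) (2 / (s t) - 1)\<close>.
\<close>

lemma add_two_divide_strict_antimono:
  fixes s t :: real
  assumes "0 < s" "s < t" "s * t < 2"
  shows "t + 2 / t < s + 2 / s"
proof -
  have "(t - s) * (s * t) < (t - s) * 2" using assms by (intro mult_strict_left_mono) auto
  then show ?thesis using assms by (simp add: field_simps)
qed

text \<open>
  The identity behind this is \<open>3 - (t + 2 / t) = (t - 1) (2 - t) / t\<close>: the two factors in the
  numerator of \<open>g\<close> are those of \<open>t - 1\<close> and \<open>2 - t\<close>.
\<close>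

lemma g_eq_power_abundancy:
  assumes "real q > 1" "real q * real q powr x > 1"
  defines "t \<equiv> power_abundancy (real q) (real q powr x)"
  shows "g q x = t + 2 / t"
proof -
  define y where "y = real q powr x"
  have y: "y > 0" "real q * y - 1 > 0" using assms by (simp_all add: y_def)
  have y': "real q powr (x + 1) = real q * y" using assms(1) by (simp add: powr_add y_def)
  define u where "u = real q * y - 1"
  define v where "v = y * (real q - 1)"
  have uv: "u > 0" "v > 0" using y assms(1) by (simp_all add: u_def v_def)
  have t: "t = u / v" by (simp add: t_def power_abundancy_def y_def u_def v_def)
  have "g q x = 3 - ((u - v) * (2 * v - u)) / (v * u)"
    unfolding g_def y' y_def[symmetric] by (simp add: u_def v_def algebra_simps)
  also have "\<dots> = u / v + 2 / (u / v)"
    using uv by (simp add: field_simps power2_eq_square)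
  finally show ?thesis by (simp add: t)
qed

text \<open>
  Split \<open>t + 2 / t\<close> into its limit as \<open>y\<close> grows, which is \<open>q / (q - 1) + 2 (q - 1) / q\<close>, and the
  two corrections \<open>- 1 / (y (q - 1))\<close> and \<open>2 (q - 1) / (q (q y - 1))\<close>. At the \<open>y\<close> with
  \<open>q y - 1 = 2 (q - 1) n\<^sup>2\<close> these are the three terms of \<open>l1\<close>.
\<close>

lemma l1_eq_power_abundancy:
  assumes "q \<ge> 2" "n > 0"
  defines "t \<equiv> power_abundancy (real q) ((2 * (real q - 1) * (real n)\<^sup>2 + 1) / real q)"
  shows "l1 q n = t + 2 / t"
proof -
  define Q where "Q = real q"
  define N where "N = (real n)\<^sup>2"
  define D where "D = 2 * Q * N - 2 * N + 1"
  have Q: "Q > 1" and N: "N > 0" using assms(1,2) by (simp_all add: Q_def N_def)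
  have D1: "D - 1 = 2 * N * (Q - 1)" by (simp add: D_def algebra_simps)
  have "2 * N * (Q - 1) > 0" using Q N by simp
  with D1 have D: "D > 1" by linarith
  have "t = power_abundancy Q (D / Q)"
    by (simp add: t_def Q_def N_def D_def algebra_simps)
  also have "\<dots> = (D - 1) * Q / (D * (Q - 1))"
    using Q D by (simp add: power_abundancy_def)
  also have "\<dots> = 2 * N * Q / D" using Q D by (simp add: D1)
  finally have t: "t = 2 * N * Q / D" .
  have "t = Q / (Q - 1) - Q / ((Q - 1) * D)"
  proof -
    have "Q / (Q - 1) - Q / ((Q - 1) * D) = Q * (D - 1) / ((Q - 1) * D)"
      using Q D by (simp add: divide_simps) (simp add: algebra_simps)
    then show ?thesis using Q D by (simp add: D1 t)
  qed
  moreover have "2 / t = 2 * (Q - 1) / Q + 1 / (Q * N)"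
    using Q D N by (simp add: t divide_simps) (simp add: D_def algebra_simps)
  moreover have "(3 * Q\<^sup>2 - 4 * Q + 2) / (Q * (Q - 1)) = Q / (Q - 1) + 2 * (Q - 1) / Q"
    using Q by (simp add: divide_simps) (simp add: algebra_simps power2_eq_square)
  moreover have "l1 q n = (3 * Q\<^sup>2 - 4 * Q + 2) / (Q * (Q - 1)) - Q / ((Q - 1) * D) + 1 / (Q * N)"
    by (simp add: l1_def Q_def N_def D_def)
  ultimately show ?thesis by simp
qed

section \<open>The lower bound\<close>

theorem theorem4:
  fixes q k n :: nat
  assumes "odd_perfect_special_prime q k n"
  shows "abundancy (q ^ k) + abundancy (n\<^sup>2) > l1 q n \<and>
         (\<exists>K::real. real k < K \<and> g q K = l1 q n)"
proof -
  note less = sigma_special_prime_power_less(1)[OF assms]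
    and prod = sigma_special_prime_power_less(2)[OF assms]
    and q5 = sigma_special_prime_power_less(3)[OF assms]
  have q: "prime q" and n: "n > 0" using assms by (auto simp: odd_perfect_special_prime_def)
  define y where "y = real (q ^ k)"
  define y\<^sub>0 where "y\<^sub>0 = (2 * (real q - 1) * (real n)\<^sup>2 + 1) / real q"
  define t where "t = power_abundancy (real q) y"
  define t\<^sub>0 where "t\<^sub>0 = power_abundancy (real q) y\<^sub>0"
  have "real q ^ k \<ge> 1" using q5 by (intro one_le_power) simp
  then have y1: "y \<ge> 1" by (simp add: y_def)
  have "(real q - 1) * real (sigma (q ^ k)) = real q * y - 1"
    using arg_cong[OF sigma_prime_power_closed[OF q, of k], of real_of_int] by (simp add: y_def)
  moreover have "(real q - 1) * real (sigma (q ^ k)) < (real q - 1) * real (2 * n\<^sup>2)"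
    using q5 less by (intro mult_strict_left_mono of_nat_less_iff[THEN iffD2]) simp_all
  ultimately have y_less: "y < y\<^sub>0"
    using q5 by (simp add: y\<^sub>0_def field_simps)
  have t_less: "t < t\<^sub>0"
    unfolding t_def t\<^sub>0_def using q5 y1 y_less by (intro power_abundancy_strict_mono) auto
  have t: "0 < t" "t < 5 / 4" and t0: "t\<^sub>0 < 5 / 4"
    unfolding t_def t\<^sub>0_def by (rule power_abundancy_bounds; use q5 y1 y_less in simp)+
  have "t * t\<^sub>0 < 5 / 4 * (5 / 4)"
    using t t0 t_less by (intro mult_strict_mono) auto
  then have "t\<^sub>0 + 2 / t\<^sub>0 < t + 2 / t"
    using t t_less by (intro add_two_divide_strict_antimono) auto
  moreover have l1: "l1 q n = t\<^sub>0 + 2 / t\<^sub>0"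
    unfolding t\<^sub>0_def y\<^sub>0_def using q5 n by (intro l1_eq_power_abundancy) auto
  moreover have t_eq: "t = abundancy (q ^ k)"
    by (simp only: t_def y_def abundancy_prime_power[OF q])
  moreover have "abundancy (q ^ k) * abundancy (n\<^sup>2) = 2"
    using arg_cong[OF prod, of real] q5 n by (simp add: abundancy_def field_simps)
  then have "abundancy (n\<^sup>2) = 2 / t"
    using t(1) by (simp add: t_eq field_simps)
  ultimately have first: "abundancy (q ^ k) + abundancy (n\<^sup>2) > l1 q n" by simp
  define K where "K = log (real q) y\<^sub>0"
  have "real q powr real k < y\<^sub>0" using y_less q5 by (simp add: y_def powr_realpow)
  then have "real k < K" using q5 y1 y_less by (simp add: K_def less_log_iff)
  have qK: "real q powr K = y\<^sub>0" using q5 y1 y_less by (simp add: K_def)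
  have "1 * 1 < real q * y\<^sub>0" using q5 y1 y_less by (intro mult_strict_mono) auto
  then have "g q K = t\<^sub>0 + 2 / t\<^sub>0"
    using g_eq_power_abundancy[of q K] q5 by (simp add: qK t\<^sub>0_def)
  with first l1 \<open>real k < K\<close> show ?thesis by auto
qed

end
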